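(* For every fixed integer $r>0$ there are infinitely many numerical semigroups with type $r$.
   Context: A numerical semigroup is a submonoid $S$ of $(\mathbb{N},+)$ ($\mathbb{N}$ the non-negative integers) with $\mathbb{N}\setminus S$ finite. A pseudo-Frobenius number of $S$ is an integer $f\in\mathbb{Z}\setminus S$ with $f+s\in S$ for all $s\in S\setminus\{0\}$; $\mathrm{PF}(S)$ is the set of these. The type of $S$ is $|\mathrm{PF}(S)|$ (which equals the Cohen-Macaulay type of the numerical semigroup ring $k[[S]]$). *)

theory Defs
  imports Main
begin

definition numerical_semigroup :: "nat set \<Rightarrow> bool" where
  "numerical_semigroup S \<longleftrightarrow>
     0 \<in> S \<and> (\<forall>x\<in>S. \<forall>y\<in>S. x + y \<in> S) \<and> finite (UNIV - S)"

text \<open>Pseudo-Frobenius numbers are integers, possibly negative: for \<open>S = UNIV\<close> the only one is \<open>-1\<close>.\<close>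

definition pseudo_frobenius :: "nat set \<Rightarrow> int set" where
  "pseudo_frobenius S = {f. f \<notin> int ` S \<and> (\<forall>s\<in>S - {0}. f + int s \<in> int ` S)}"

definition semigroup_type :: "nat set \<Rightarrow> nat" where
  "semigroup_type S = card (pseudo_frobenius S)"

end

theory Submission
  imports Defs
begin

text \<open>
  Fix \<open>m = r + 1\<close> and let \<open>k\<close> vary. The semigroup consisting of the multiples of \<open>m\<close>, together
  with every number from \<open>(k + 1) * m\<close> on, has type \<open>m - 1 = r\<close> whatever \<open>k\<close> is: adding
  \<open>m\<close> preserves the residue class, so a gap \<open>f\<close> not divisible by \<open>m\<close> can only be
  pseudo-Frobenius if \<open>f + m\<close> already reaches \<open>(k + 1) * m\<close>. This leaves exactly the \<open>m - 1\<close>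
  numbers strictly between the consecutive multiples \<open>k * m\<close> and \<open>(k + 1) * m\<close>
  (lemma \<open>pseudo_frobenius_truncated_multiples\<close>). Different \<open>k\<close> give different semigroups,
  hence there are infinitely many of type \<open>r\<close>.
\<close>

definition truncated_multiples :: "nat \<Rightarrow> nat \<Rightarrow> nat set" where
  "truncated_multiples m k = {n. m dvd n \<or> (k + 1) * m \<le> n}"

lemma numerical_semigroup_truncated_multiples:
  "numerical_semigroup (truncated_multiples m k)"
proof -
  have "UNIV - truncated_multiples m k \<subseteq> {..<(k + 1) * m}"
    by (auto simp: truncated_multiples_def)
  then have "finite (UNIV - truncated_multiples m k)"
    by (rule finite_subset) simp
  then show ?thesis
    by (auto simp: numerical_semigroup_def truncated_multiples_def)
qed

lemma int_mem_truncated_multiples_iff: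
  "f \<in> int ` truncated_multiples m k \<longleftrightarrow>
     0 \<le> f \<and> (int m dvd f \<or> int ((k + 1) * m) \<le> f)"
proof
  assume "f \<in> int ` truncated_multiples m k"
  then obtain n where "f = int n" "m dvd n \<or> (k + 1) * m \<le> n"
    by (auto simp: truncated_multiples_def)
  then show "0 \<le> f \<and> (int m dvd f \<or> int ((k + 1) * m) \<le> f)"
    by (metis int_dvd_int_iff of_nat_0_le_iff of_nat_le_iff)
next
  assume f: "0 \<le> f \<and> (int m dvd f \<or> int ((k + 1) * m) \<le> f)"
  then obtain n where n: "f = int n"
    using nonneg_int_cases by blast
  then have "m dvd n \<or> (k + 1) * m \<le> n"
    using f by (metis int_dvd_int_iff of_nat_le_iff)
  then show "f \<in> int ` truncated_multiples m k"
    using n by (auto simp: truncated_multiples_def)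
qed

text \<open>
  Since pseudo-Frobenius numbers may be negative, the negative multiples of \<open>m\<close> have to be
  excluded separately: nonzero multiples of \<open>m\<close> alone would not rule out \<open>- m\<close>, as adding
  them always lands in the semigroup. A large element congruent to \<open>1\<close> modulo \<open>m\<close> shifts such a number to
  the gap \<open>k * m + 1\<close>; this is where \<open>m \<ge> 2\<close> enters.
\<close>

lemma pseudo_frobenius_truncated_multiples:
  assumes "m \<ge> 2"
  shows "pseudo_frobenius (truncated_multiples m k) = int ` {k * m<..<(k + 1) * m}"
proof (intro equalityI subsetI)
  fix f assume "f \<in> pseudo_frobenius (truncated_multiples m k)"
  then have notin: "f \<notin> int ` truncated_multiples m k"
    and add: "\<And>s. s \<in> truncated_multiples m k \<Longrightarrow> s \<noteq> 0 \<Longrightarrow>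
                f + int s \<in> int ` truncated_multiples m k"
    by (auto simp: pseudo_frobenius_def)
  have ndvd: "\<not> int m dvd f"
  proof
    assume "int m dvd f"
    then have "f < 0"
      using notin by (auto simp: int_mem_truncated_multiples_iff)
    define s where "s = k * m + 1 + nat (- f)"
    have s: "int s = int (k * m + 1) - f"
      using \<open>f < 0\<close> by (simp add: s_def)
    \<comment> \<open>A negative multiple of \<open>m\<close> is at most \<open>- m\<close>, so \<open>s\<close> lies beyond \<open>(k + 1) * m\<close>.\<close>
    have "int m \<le> - f"
      using \<open>int m dvd f\<close> \<open>f < 0\<close> by (intro zdvd_imp_le) auto
    then have "(k + 1) * m \<le> s"
      by (simp add: s_def)
    then have "f + int s \<in> int ` truncated_multiples m k"
      by (intro add) (auto simp: truncated_multiples_def s_def)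
    moreover have "f + int s = int (k * m + 1)"
      using s by simp
    ultimately have "k * m + 1 \<in> truncated_multiples m k"
      by (metis image_iff of_nat_eq_iff)
    then have "m dvd k * m + 1"
      using assms by (auto simp: truncated_multiples_def)
    then have "m dvd 1"
      by (metis dvd_add_right_iff dvd_triv_right)
    then show False
      using assms by simp
  qed
  have "f + int m \<in> int ` truncated_multiples m k"
    using assms by (intro add) (auto simp: truncated_multiples_def)
  then have "int ((k + 1) * m) \<le> f + int m"
    using ndvd by (auto simp: int_mem_truncated_multiples_iff)
  then have lower: "int (k * m) \<le> f"
    by (simp add: algebra_simps)
  moreover have "f \<noteq> int (k * m)"
    using ndvd by auto
  moreover have "0 \<le> f"
    using lower by (rule order_trans[rotated]) simp
  then have "f < int ((k + 1) * m)"
    using notin \<open>0 \<le> f\<close> by (metis int_mem_truncated_multiples_iff linorder_not_le)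
  moreover obtain n where "f = int n"
    using \<open>0 \<le> f\<close> nonneg_int_cases by blast
  ultimately show "f \<in> int ` {k * m<..<(k + 1) * m}"
    by (metis greaterThanLessThan_iff imageI of_nat_le_iff of_nat_less_iff order_le_less)
next
  fix f assume "f \<in> int ` {k * m<..<(k + 1) * m}"
  then obtain n where n: "f = int n" "k * m < n" "n < (k + 1) * m"
    by auto
  have "\<not> m dvd n"
  proof
    assume "m dvd n"
    then obtain j where "n = j * m"
      by (metis dvdE mult.commute)
    then have "k < j" "j < k + 1"
      using n by (metis mult_less_cancel2)+
    then show False
      by simp
  qed
  then have "n \<notin> truncated_multiples m k"
    using n by (simp add: truncated_multiples_def)
  moreover have "n + s \<in> truncated_multiples m k"
    if "s \<in> truncated_multiples m k" "s \<noteq> 0" for s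
  proof -
    have "m \<le> s"
      using that by (auto simp: truncated_multiples_def dvd_imp_le)
    then show ?thesis
      using n by (simp add: truncated_multiples_def)
  qed
  ultimately show "f \<in> pseudo_frobenius (truncated_multiples m k)"
    unfolding pseudo_frobenius_def n(1)
    by (auto simp: image_iff simp flip: of_nat_add)
qed

lemma semigroup_type_truncated_multiples:
  assumes "m \<ge> 2"
  shows "semigroup_type (truncated_multiples m k) = m - 1"
  using assms
  by (simp add: semigroup_type_def pseudo_frobenius_truncated_multiples card_image)

text \<open>
  The set determines \<open>k\<close> because the numbers \<open>j * m + 1\<close> probe it: such a number is a gap
  exactly when \<open>j \<le> k\<close>.
\<close>

lemma inj_truncated_multiples:
  assumes "m \<ge> 2"
  shows "inj (truncated_multiples m)"
proof (rule injI)
  have probe: "j * m + 1 \<in> truncated_multiples m k \<longleftrightarrow> k < j" for j k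
  proof -
    have "\<not> m dvd j * m + 1"
      using assms by (metis dvd_add_right_iff dvd_triv_right nat_dvd_1_iff_1 numeral_le_one_iff
          semiring_norm(69))
    moreover have "(k + 1) * m \<le> j * m + 1 \<longleftrightarrow> k < j"
    proof
      assume le: "(k + 1) * m \<le> j * m + 1"
      show "k < j"
      proof (rule ccontr)
        assume "\<not> k < j"
        then have "j * m \<le> k * m"
          by simp
        then show False
          using le assms unfolding distrib_right by linarith
      qed
    next
      assume "k < j"
      then have "(k + 1) * m \<le> j * m"
        by (intro mult_le_mono1) simp
      then show "(k + 1) * m \<le> j * m + 1"
        by simp
    qed
    ultimately show ?thesis
      by (simp add: truncated_multiples_def)
  qed
  fix k l assume "truncated_multiples m k = truncated_multiples m l"
  then have "k < j \<longleftrightarrow> l < j" for j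
    using probe by metis
  then show "k = l"
    by (metis less_irrefl linorder_neqE_nat)
qed

theorem mainTheorem10:
  fixes r :: nat
  assumes "r > 0"
  shows "infinite {S :: nat set. numerical_semigroup S \<and> semigroup_type S = r}"
proof -
  have m: "r + 1 \<ge> 2"
    using assms by simp
  have "infinite (range (truncated_multiples (r + 1)))"
    using inj_truncated_multiples[OF m] finite_imageD infinite_UNIV_nat by blast
  moreover have "range (truncated_multiples (r + 1)) \<subseteq>
      {S. numerical_semigroup S \<and> semigroup_type S = r}"
    using semigroup_type_truncated_multiples[OF m]
    by (auto simp: numerical_semigroup_truncated_multiples)
  ultimately show ?thesis
    using infinite_super by blast
qed

end
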